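(* Let $\Omega\subset\mathbb{R}$ be a bounded open interval, let $1<p<\infty$ and $q=\frac{p}{p-1}$. There is a constant $C$, independent of $f$ and of the partition (in particular of $h$), such that the following holds. Let $V_h\subset H_0^1(\Omega)$ be the finite element space of piecewise polynomials of degree at most $r-1$, $r\ge2$, associated with a partition $\mathcal{T}_h$ of $\Omega$, let $f\in L^2(\Omega)$, and let $(u_h,v_h)\in V_h\times V_h$ be the discrete solution, i.e. $$(\nabla v_h,\nabla\psi_h) = -(f,\psi_h) \quad \forall\,\psi_h\in V_h, \qquad (\nabla u_h,\nabla\eta_h) = -(|v_h|^{q-2}v_h,\eta_h) \quad \forall\,\eta_h\in V_h .$$ Then $$\|v_h\|_{H_0^1(\Omega)}\le C\|f\|_{L^2(\Omega)}, \qquad \|u_h\|_{H_0^1(\Omega)}\le C\|f\|_{L^2(\Omega)}^{q-1}.$$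
   Context: $(\cdot,\cdot)$ denotes the $L^2(\Omega)$ inner product, and $\nabla$ is the (weak) derivative in dimension one. $\mathcal{T}_h$ is a partition of $\Omega$ into finitely many nondegenerate intervals $T_1,\dots,T_n$ with pairwise disjoint interiors, whose parameter $h$ is the mesh size. For an integer $r\ge 2$, $$V_h=\{w\in C(\overline\Omega): w=0 \text{ on } \partial\Omega,\ w|_{T_k} \text{ is a polynomial of degree at most } r-1 \text{ for every } T_k\in\mathcal{T}_h\}.$$ The expression $|v_h|^{q-2}v_h$ is understood to be $0$ where $v_h=0$. On $H_0^1(\Omega)$ the norm may be taken to be the equivalent norm $\|\nabla w\|_{L^2(\Omega)}$. *)

theory Defs
  imports "HOL-Analysis.Analysis" "HOL-Computational_Algebra.Polynomial"
begin

(* Functions on a set W are total functions real => real; only their values on W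
   (on closure W for finite element functions) are ever used. *)

definition L2 :: "real set \<Rightarrow> (real \<Rightarrow> real) set" where
  "L2 W = {f. f \<in> borel_measurable (lebesgue_on W) \<and> integrable (lebesgue_on W) (\<lambda>x. (f x)\<^sup>2)}"

definition L2_inner :: "real set \<Rightarrow> (real \<Rightarrow> real) \<Rightarrow> (real \<Rightarrow> real) \<Rightarrow> real" where
  "L2_inner W f g = (LINT x|lebesgue_on W. f x * g x)"

definition L2_norm :: "real set \<Rightarrow> (real \<Rightarrow> real) \<Rightarrow> real" where
  "L2_norm W f = sqrt (LINT x|lebesgue_on W. (f x)\<^sup>2)"

definition test_function :: "real set \<Rightarrow> (real \<Rightarrow> real) \<Rightarrow> bool" where
  "test_function W \<phi> \<longleftrightarrow>
     (\<forall>n x. (deriv ^^ n) \<phi> field_differentiable (at x)) \<and>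
     compact (closure {x. \<phi> x \<noteq> 0}) \<and> closure {x. \<phi> x \<noteq> 0} \<subseteq> W"

definition locally_integrable :: "real set \<Rightarrow> (real \<Rightarrow> real) \<Rightarrow> bool" where
  "locally_integrable W f \<longleftrightarrow> (\<forall>K. compact K \<and> K \<subseteq> W \<longrightarrow> integrable (lebesgue_on K) f)"

definition has_weak_deriv :: "real set \<Rightarrow> (real \<Rightarrow> real) \<Rightarrow> (real \<Rightarrow> real) \<Rightarrow> bool" where
  "has_weak_deriv W w g \<longleftrightarrow>
     locally_integrable W w \<and> locally_integrable W g \<and>
     (\<forall>\<phi>. test_function W \<phi> \<longrightarrow>
        (LINT x|lebesgue_on W. w x * deriv \<phi> x) = - (LINT x|lebesgue_on W. g x * \<phi> x))"

(* A representative; for open W weak derivatives are unique almost everywhere on W, so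
   integrals over W involving weak_deriv do not depend on the choice. *)
definition weak_deriv :: "real set \<Rightarrow> (real \<Rightarrow> real) \<Rightarrow> real \<Rightarrow> real" where
  "weak_deriv W w = (SOME g. has_weak_deriv W w g)"

(* The gradient norm, which on H^1_0(W) is equivalent to the full H^1 norm for bounded W. *)
definition H10_norm :: "real set \<Rightarrow> (real \<Rightarrow> real) \<Rightarrow> real" where
  "H10_norm W w = L2_norm W (weak_deriv W w)"

(* The elements are closed intervals covering closure W; division_of alone would also
   admit one-point intervals. *)
definition mesh :: "real set \<Rightarrow> real set set \<Rightarrow> bool" where
  "mesh W \<T> \<longleftrightarrow> \<T> division_of (closure W) \<and> (\<forall>T\<in>\<T>. interior T \<noteq> {})"

definition fe_space :: "real set \<Rightarrow> real set set \<Rightarrow> nat \<Rightarrow> (real \<Rightarrow> real) set" where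
  "fe_space W \<T> r =
     {w. continuous_on (closure W) w \<and> (\<forall>x\<in>frontier W. w x = 0) \<and>
         (\<forall>T\<in>\<T>. \<exists>P :: real poly. degree P \<le> r - 1 \<and> (\<forall>x\<in>T. w x = poly P x))}"

(* The nonlinearity |s|^(q-2) s: for s = 0 it is 0 because of the factor s. *)
definition duality_map :: "real \<Rightarrow> real \<Rightarrow> real" where
  "duality_map q s = \<bar>s\<bar> powr (q - 2) * s"

definition discrete_solution ::
  "real set \<Rightarrow> real set set \<Rightarrow> nat \<Rightarrow> real \<Rightarrow> (real \<Rightarrow> real) \<Rightarrow> (real \<Rightarrow> real) \<Rightarrow> (real \<Rightarrow> real) \<Rightarrow> bool"
  where
  "discrete_solution W \<T> r q f u v \<longleftrightarrow>
     u \<in> fe_space W \<T> r \<and> v \<in> fe_space W \<T> r \<and>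
     (\<forall>\<psi>\<in>fe_space W \<T> r.
        L2_inner W (weak_deriv W v) (weak_deriv W \<psi>) = - L2_inner W f \<psi>) \<and>
     (\<forall>\<eta>\<in>fe_space W \<T> r.
        L2_inner W (weak_deriv W u) (weak_deriv W \<eta>) = - L2_inner W (\<lambda>x. duality_map q (v x)) \<eta>)"

end

theory Submission
  imports Defs
begin

text \<open>Write \<open>L = b - a\<close>. Each equation of the discrete problem is tested with its own solution. Both
estimates then follow from the one-dimensional Poincare inequality
\<open>\<bar>w x\<bar> \<le> sqrt L * H10_norm w\<close> (\<open>fe_space_pointwise_bound\<close>), whose constant does not see the mesh.

Taking \<open>\<psi> = v\<close> gives \<open>H10_norm v ^ 2 = - (f, v)\<close>. The right-hand side is at most the maximum of
\<open>\<bar>v\<bar>\<close> times the \<open>L1\<close> norm of \<open>f\<close>, hence at most \<open>L * L2_norm f * H10_norm v\<close>; cancelling one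
factor gives \<open>H10_norm v \<le> L * L2_norm f\<close>. Taking \<open>\<eta> = u\<close> gives
\<open>H10_norm u ^ 2 \<le> L * (max \<bar>v\<bar>) powr (q - 1) * max \<bar>u\<bar>\<close>, because the nonlinearity has absolute
value \<open>\<bar>v\<bar> powr (q - 1)\<close>; bounding both maxima, and then \<open>H10_norm v\<close> by the first estimate, gives
the second. Since \<open>q - 1 > 0\<close>, the power is monotone.

The work lies in relating \<open>weak_deriv W w\<close>, an arbitrarily chosen weak derivative, to the function
\<open>w\<close> itself. A finite element function has a bounded classical derivative off the finitely many
nodes, and integration by parts shows that this piecewise derivative is a weak derivative
(\<open>has_weak_deriv_piecewise\<close>). Weak derivatives agree almost everywhere
(\<open>has_weak_deriv_unique_AE\<close>), so the \<open>H10_norm\<close> is the \<open>L2_norm\<close> of the piecewise derivative, to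
which the fundamental theorem of calculus and the Cauchy-Schwarz inequality apply. Uniqueness in
turn needs enough test functions; they are built from the flat function \<open>exp (- 1 / x)\<close>.\<close>

section \<open>Smooth bump functions\<close>

text \<open>The polynomial factor makes the family closed under differentiation: with \<open>y = 1 / x\<close>, the
derivative of \<open>P(y) exp(-y)\<close> in \<open>x\<close> is \<open>y\<^sup>2 (P(y) - P'(y)) exp(-y)\<close>.\<close>

definition flat_exp :: "real poly \<Rightarrow> real \<Rightarrow> real" where
  "flat_exp P x = (if 0 < x then poly P (1 / x) * exp (- (1 / x)) else 0)"

lemma poly_times_exp_minus_tendsto_0:
  fixes P :: "real poly"
  shows "((\<lambda>y. poly P y * exp (- y)) \<longlongrightarrow> 0) at_top"
proof -
  have "((\<lambda>y. \<Sum>i\<le>degree P. coeff P i * (y ^ i / exp y)) \<longlongrightarrow> (\<Sum>i\<le>degree P. coeff P i * 0)) at_top"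
    by (intro tendsto_intros tendsto_power_div_exp_0)
  then show ?thesis
    by (simp add: poly_altdef sum_distrib_right exp_minus divide_inverse mult.assoc)
qed

text \<open>At \<open>0\<close> the exponential beats every power of \<open>1 / x\<close>, so the difference quotient still tends to \<open>0\<close>;
elsewhere this is the chain rule.\<close>

lemma flat_exp_has_derivative:
  "(flat_exp P has_field_derivative flat_exp ([:0, 0, 1:] * (P - pderiv P)) x) (at x)"
proof -
  consider "x < 0" | "x > 0" | "x = 0" by linarith
  then show ?thesis
  proof cases
    case 1
    have "((\<lambda>x. 0) has_field_derivative 0) (at x)" by simp
    moreover have "\<forall>\<^sub>F y in nhds x. flat_exp P y = 0"
      using eventually_nhds_in_open[of "{..<0}" x] 1
      by (auto elim!: eventually_mono simp: flat_exp_def)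
    ultimately show ?thesis
      using 1 by (subst DERIV_cong_ev[OF refl _ refl, where g = "\<lambda>x. 0"]) (auto simp: flat_exp_def)
  next
    case 2
    have "((\<lambda>y. poly P (1 / y) * exp (- (1 / y))) has_field_derivative
        flat_exp ([:0, 0, 1:] * (P - pderiv P)) x) (at x)"
      using 2 by (auto intro!: derivative_eq_intros poly_DERIV[THEN DERIV_chain2]
          simp: flat_exp_def field_simps power2_eq_square)
    moreover have "\<forall>\<^sub>F y in nhds x. flat_exp P y = poly P (1 / y) * exp (- (1 / y))"
      using eventually_nhds_in_open[of "{0<..}" x] 2
      by (auto elim!: eventually_mono simp: flat_exp_def)
    ultimately show ?thesis
      by (subst DERIV_cong_ev[OF refl _ refl])
  next
    case 3
    \<comment> \<open>The factor \<open>1 / h\<close> of the difference quotient is absorbed into the polynomial.\<close>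
    have "((\<lambda>h. poly ([:0, 1:] * P) (inverse h) * exp (- inverse h)) \<longlongrightarrow> 0) (at_right 0)"
      using filterlim_compose[OF poly_times_exp_minus_tendsto_0 filterlim_inverse_at_top_right]
      by blast
    then have "((\<lambda>h. flat_exp P h / h) \<longlongrightarrow> 0) (at_right 0)"
      by (rule Lim_transform_eventually)
        (auto simp: flat_exp_def eventually_at_right_less field_simps intro: eventually_mono[OF eventually_at_right_less])
    moreover have "((\<lambda>h. flat_exp P h / h) \<longlongrightarrow> 0) (at_left 0)"
      by (rule Lim_transform_eventually[OF tendsto_const])
        (auto simp: flat_exp_def eventually_at_left_real intro!: eventually_at_leftI[of "-1"])
    ultimately have "((\<lambda>h. flat_exp P h / h) \<longlongrightarrow> 0) (at 0)"
      by (simp add: filterlim_split_at)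
    then show ?thesis
      using 3 by (simp add: DERIV_def flat_exp_def)
  qed
qed

text \<open>A set of functions that is closed under differentiation consists of smooth functions. Products of
flat functions are needed for bumps; closing under sums and products keeps the derivatives inside by
the product rule.\<close>

inductive_set flat_exp_algebra :: "(real \<Rightarrow> real) set" where
  affine: "(\<lambda>x. flat_exp P (s * x + t)) \<in> flat_exp_algebra"
| add: "f \<in> flat_exp_algebra \<Longrightarrow> g \<in> flat_exp_algebra \<Longrightarrow> (\<lambda>x. f x + g x) \<in> flat_exp_algebra"
| mult: "f \<in> flat_exp_algebra \<Longrightarrow> g \<in> flat_exp_algebra \<Longrightarrow> (\<lambda>x. f x * g x) \<in> flat_exp_algebra"

lemma flat_exp_algebra_derivative:
  assumes "f \<in> flat_exp_algebra"
  shows "\<exists>f'\<in>flat_exp_algebra. \<forall>x. (f has_field_derivative f' x) (at x)"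
  using assms
proof induction
  case (affine P s t)
  let ?P' = "smult s ([:0, 0, 1:] * (P - pderiv P))"
  have "((\<lambda>x. flat_exp P (s * x + t)) has_field_derivative flat_exp ?P' (s * x + t)) (at x)" for x
  proof -
    have "((\<lambda>x. s * x + t) has_field_derivative s) (at x)"
      by (auto intro!: derivative_eq_intros)
    then have "((\<lambda>x. flat_exp P (s * x + t)) has_field_derivative
        flat_exp ([:0, 0, 1:] * (P - pderiv P)) (s * x + t) * s) (at x)"
      by (rule DERIV_chain2[OF flat_exp_has_derivative])
    moreover have "flat_exp (smult s Q) y = flat_exp Q y * s" for Q y
      by (simp add: flat_exp_def)
    ultimately show ?thesis
      by (simp only:)
  qed
  then show ?case
    by (intro bexI[of _ "\<lambda>x. flat_exp ?P' (s * x + t)"] allI flat_exp_algebra.affine)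
next
  case (add f g)
  then obtain f' g' where "f' \<in> flat_exp_algebra" "g' \<in> flat_exp_algebra"
    "\<forall>x. (f has_field_derivative f' x) (at x)" "\<forall>x. (g has_field_derivative g' x) (at x)"
    by blast
  then show ?case
    by (intro bexI[of _ "\<lambda>x. f' x + g' x"] allI DERIV_add flat_exp_algebra.add) auto
next
  case (mult f g)
  then obtain f' g' where "f' \<in> flat_exp_algebra" "g' \<in> flat_exp_algebra"
    "\<forall>x. (f has_field_derivative f' x) (at x)" "\<forall>x. (g has_field_derivative g' x) (at x)"
    by blast
  with mult.hyps show ?case
    by (intro bexI[of _ "\<lambda>x. f' x * g x + g' x * f x"] allI DERIV_mult
        flat_exp_algebra.add flat_exp_algebra.mult) auto
qed

lemma flat_exp_algebra_smooth:
  assumes "f \<in> flat_exp_algebra"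
  shows "(deriv ^^ n) f field_differentiable (at x)"
proof -
  have "(deriv ^^ n) f \<in> flat_exp_algebra"
  proof (induction n)
    case (Suc n)
    then obtain f' where "f' \<in> flat_exp_algebra" "\<forall>x. ((deriv ^^ n) f has_field_derivative f' x) (at x)"
      using flat_exp_algebra_derivative by blast
    then show ?case
      by (metis DERIV_imp_deriv comp_apply ext funpow.simps(2))
  qed (use assms in simp)
  then show ?thesis
    using flat_exp_algebra_derivative field_differentiable_def by blast
qed

text \<open>Rescaling the argument by \<open>n + 1\<close> takes the \<open>(n + 1)\<close>-th root of each exponential factor, so these
bumps increase with \<open>n\<close> to the indicator function of \<open>(c, d)\<close> while their support stays fixed.\<close>

definition bump :: "real \<Rightarrow> real \<Rightarrow> nat \<Rightarrow> real \<Rightarrow> real" where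
  "bump c d n x = flat_exp 1 (real (Suc n) * (x - c)) * flat_exp 1 (real (Suc n) * (d - x))"

lemma bump_eq_0_iff: "bump c d n x = 0 \<longleftrightarrow> x \<notin> {c<..<d}"
  by (auto simp: bump_def flat_exp_def mult_pos_pos zero_less_mult_iff simp del: of_nat_Suc)

lemma bump_bounds: "0 \<le> bump c d n x" "bump c d n x \<le> 1"
  by (auto simp: bump_def flat_exp_def mult_le_one)

lemma bump_tendsto_1:
  assumes "c < x" "x < d"
  shows "(\<lambda>n. bump c d n x) \<longlonglongrightarrow> 1"
proof -
  have *: "(\<lambda>n. flat_exp 1 (real (Suc n) * y)) \<longlonglongrightarrow> 1" if "0 < y" for y
  proof -
    have "(\<lambda>n. exp (- (inverse (real (Suc n)) * (1 / y)))) \<longlonglongrightarrow> exp (- (0 * (1 / y)))"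
      by (intro tendsto_intros LIMSEQ_inverse_real_of_nat)
    then show ?thesis
      using that by (simp add: flat_exp_def divide_inverse mult.commute del: of_nat_Suc)
  qed
  show ?thesis
    using tendsto_mult[OF *[of "x - c"] *[of "d - x"]] assms by (simp add: bump_def del: of_nat_Suc)
qed

lemma test_function_bump:
  assumes "a < c" "c < d" "d < b"
  shows "test_function {a<..<b} (bump c d n)"
proof -
  have "bump c d n = (\<lambda>x. flat_exp 1 (real (Suc n) * x + - real (Suc n) * c) *
      flat_exp 1 (- real (Suc n) * x + real (Suc n) * d))"
    by (auto simp: bump_def algebra_simps)
  also have "\<dots> \<in> flat_exp_algebra"
    by (intro flat_exp_algebra.intros)
  finally have "(deriv ^^ k) (bump c d n) field_differentiable (at x)" for k x
    by (rule flat_exp_algebra_smooth)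
  moreover have "{x. bump c d n x \<noteq> 0} = {c<..<d}"
    by (auto simp: bump_eq_0_iff)
  ultimately show ?thesis
    using assms by (auto simp: test_function_def)
qed

section \<open>Uniqueness of weak derivatives\<close>

lemma integrable_lebesgue_on_bounded:
  fixes f :: "real \<Rightarrow> real"
  assumes "S \<in> lmeasurable" "f \<in> borel_measurable (lebesgue_on S)"
    and "\<And>x. x \<in> S \<Longrightarrow> \<bar>f x\<bar> \<le> B"
  shows "integrable (lebesgue_on S) f"
proof -
  interpret finite_measure "lebesgue_on S"
    using assms by (intro finite_measure_lebesgue_on)
  show ?thesis
    using assms by (intro integrable_const_bound[where B = B]) (auto intro!: AE_I2)
qed

lemma LINT_Ioo_eq_integral_Icc:
  fixes f :: "real \<Rightarrow> real"
  assumes "integrable (lebesgue_on {a<..<b}) f"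
  shows "(LINT x|lebesgue_on {a<..<b}. f x) = integral {a..b} f"
  using lebesgue_integral_eq_integral[OF assms] by (simp add: integral_open_interval_real)

lemma has_weak_deriv_integrable_Icc:
  assumes "has_weak_deriv {a<..<b} w g" and "a < c" "d < b"
  shows "integrable (lebesgue_on {c..d}) g"
proof -
  have "compact {c..d}" "{c..d} \<subseteq> {a<..<b}"
    using assms by auto
  then show ?thesis
    using assms unfolding has_weak_deriv_def locally_integrable_def by blast
qed

text \<open>Testing both derivatives with the bumps gives equal integrals against every bump; as the bumps
converge boundedly to the indicator of \<open>(c, d)\<close>, dominated convergence passes to the limit.\<close>

lemma weak_deriv_LINT_Icc_unique:
  assumes g: "has_weak_deriv {a<..<b} w g" and h: "has_weak_deriv {a<..<b} w h"
    and cd: "a < c" "c < d" "d < b"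
  shows "(LINT x|lebesgue_on {c..d}. g x - h x) = 0"
proof -
  have int: "integrable (lebesgue_on {c..d}) g" "integrable (lebesgue_on {c..d}) h"
    using g h cd by (auto intro: has_weak_deriv_integrable_Icc)
  have meas: "bump c d n \<in> borel_measurable (lebesgue_on {c..d})" for n
  proof (rule continuous_imp_measurable_on_sets_lebesgue)
    have "bump c d n field_differentiable (at x)" for x
      using test_function_bump[OF cd, of n] unfolding test_function_def by (metis funpow_0)
    then show "continuous_on {c..d} (bump c d n)"
      by (intro continuous_at_imp_continuous_on)
        (simp add: field_differentiable_imp_continuous_at)
  qed simp
  have int_bump: "integrable (lebesgue_on {c..d}) (\<lambda>x. k x * bump c d n x)"
    if "integrable (lebesgue_on {c..d}) k" for k n
    using that meas bump_bounds
    by (intro Bochner_Integration.integrable_bound[OF that])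
      (auto intro!: AE_I2 mult_left_le simp: abs_mult)
  have restr: "(LINT x|lebesgue_on {a<..<b}. k x * bump c d n x) =
      (LINT x|lebesgue_on {c..d}. k x * bump c d n x)" for k n
  proof -
    \<comment> \<open>The support of the bump lies in \<open>[c, d]\<close>, where the weak derivatives are integrable; over \<open>(a, b)\<close> they need not be.\<close>
    have "(\<lambda>x. k x * bump c d n x) = (\<lambda>x. if x \<in> {c..d} then k x * bump c d n x else 0)"
    proof
      show "k x * bump c d n x = (if x \<in> {c..d} then k x * bump c d n x else 0)" for x
        using bump_eq_0_iff[of c d n x] by auto
    qed
    moreover have "(LINT x|lebesgue_on {a<..<b}. (if x \<in> {c..d} then k x * bump c d n x else 0)) =
        (LINT x|lebesgue_on {c..d}. k x * bump c d n x)"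
      using cd by (intro integral_restrict) auto
    ultimately show ?thesis
      by (simp only:)
  qed
  have zero: "(LINT x|lebesgue_on {c..d}. (g x - h x) * bump c d n x) = 0" for n
  proof -
    have "(LINT x|lebesgue_on {c..d}. k x * bump c d n x) =
        - (LINT x|lebesgue_on {a<..<b}. w x * deriv (bump c d n) x)"
      if "has_weak_deriv {a<..<b} w k" for k
    proof -
      have "(LINT x|lebesgue_on {a<..<b}. w x * deriv (bump c d n) x) =
          - (LINT x|lebesgue_on {a<..<b}. k x * bump c d n x)"
        using that test_function_bump[OF cd] unfolding has_weak_deriv_def by blast
      then show ?thesis
        by (simp only: restr minus_minus)
    qed
    from this[OF g] this[OF h]
    have "(LINT x|lebesgue_on {c..d}. g x * bump c d n x) =
        (LINT x|lebesgue_on {c..d}. h x * bump c d n x)"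
      by simp
    then show ?thesis
      using int int_bump by (simp add: left_diff_distrib)
  qed
  have "(\<lambda>n. LINT x|lebesgue_on {c..d}. (g x - h x) * bump c d n x) \<longlonglongrightarrow>
      (LINT x|lebesgue_on {c..d}. g x - h x)"
  proof (rule integral_dominated_convergence[where w = "\<lambda>x. \<bar>g x - h x\<bar>"])
    show "AE x in lebesgue_on {c..d}. (\<lambda>n. (g x - h x) * bump c d n x) \<longlonglongrightarrow> g x - h x"
    proof -
      have "AE x in lebesgue. x \<notin> {c, d}"
        by (intro AE_not_in finite_imp_null_set_lborel[THEN null_sets_completionI]) simp
      then have "AE x in lebesgue. x \<in> {c..d} \<longrightarrow> x \<notin> {c, d}"
        by (rule eventually_mono) simp
      then have "AE x in lebesgue_on {c..d}. x \<notin> {c, d}"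
        by (rule iffD2[OF AE_restrict_space_iff, rotated]) simp
      then show ?thesis
        by (rule lebesgue_on_mono)
          (auto intro!: tendsto_eq_intros bump_tendsto_1 simp: less_le)
    qed
    show "AE x in lebesgue_on {c..d}. norm ((g x - h x) * bump c d n x) \<le> \<bar>g x - h x\<bar>" for n
      using bump_bounds by (auto intro!: AE_I2 mult_left_le simp: abs_mult)
  qed (use int meas in auto)
  then show ?thesis
    by (simp add: zero LIMSEQ_const_iff)
qed

text \<open>By the Lebesgue differentiation theorem a locally integrable function is almost everywhere the limit
of its averages over shrinking intervals, and here these averages all vanish. That theorem asks for
integrability on every interval of the line, so \<open>f\<close> is first cut off to a compact subinterval; the
interval \<open>(a, b)\<close> is then exhausted by countably many of them.\<close>

lemma AE_eq_0_if_LINT_Icc_eq_0: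
  fixes f :: "real \<Rightarrow> real"
  assumes loc: "\<And>c d. a < c \<Longrightarrow> c < d \<Longrightarrow> d < b \<Longrightarrow> integrable (lebesgue_on {c..d}) f"
    and zero: "\<And>c d. a < c \<Longrightarrow> c < d \<Longrightarrow> d < b \<Longrightarrow> (LINT x|lebesgue_on {c..d}. f x) = 0"
  shows "AE x in lebesgue_on {a<..<b}. f x = 0"
proof -
  have on_Icc: "negligible {x \<in> {c..d}. f x \<noteq> 0}" if cd: "a < c" "c < d" "d < b" for c d
  proof -
    let ?F = "\<lambda>x. if x \<in> {c..d} then f x else 0"
    \<comment> \<open>On any interval, the cut-off function is integrated over an interval inside \<open>(a, b)\<close> or over a null set.\<close>
    have F: "(?F has_integral 0) (cbox s t)" for s t
    proof -
      have "(f has_integral 0) {max c s..min d t}"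
      proof (cases "max c s < min d t")
        case True
        then have *: "a < max c s" "min d t < b" using cd by auto
        show ?thesis
          using has_integral_integral_lebesgue_on[OF loc[OF *(1) True *(2)]] zero[OF *(1) True *(2)]
          by simp
      next
        case False
        then show ?thesis
          using has_integral_null_real[of "max c s" "min d t" f] by (simp only: content_real_eq_0 not_less)
      qed
      moreover have "{max c s..min d t} = {c..d} \<inter> {s..t}" by auto
      ultimately show ?thesis
        by (simp only: box_real has_integral_restrict_Int)
    qed
    obtain N where N: "negligible N"
      "\<And>x e. x \<notin> N \<Longrightarrow> 0 < e \<Longrightarrow> \<exists>\<delta>>0. \<forall>h. 0 < h \<and> h < \<delta> \<longrightarrow>
         norm (integral (cbox x (x + h *\<^sub>R One)) ?F /\<^sub>R h ^ DIM(real) - ?F x) < e"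
      by (rule integrable_ccontinuous_explicit[of ?F]) (use F in \<open>auto simp: integrable_on_def\<close>)
    have "?F x = 0" if "x \<notin> N" for x
    proof (rule ccontr)
      assume "?F x \<noteq> 0"
      then have "0 < \<bar>?F x\<bar>" by simp
      from N(2)[OF that this] obtain \<delta> where "\<delta> > 0"
        and "\<And>h. 0 < h \<Longrightarrow> h < \<delta> \<Longrightarrow>
          norm (integral (cbox x (x + h *\<^sub>R One)) ?F /\<^sub>R h ^ DIM(real) - ?F x) < \<bar>?F x\<bar>"
        by blast
      from this(2)[of "\<delta> / 2"] \<open>\<delta> > 0\<close> show False
        by (simp only: integral_unique[OF F]) simp
    qed
    then have "{x \<in> {c..d}. f x \<noteq> 0} \<subseteq> N" by force
    with N(1) show ?thesis by (rule negligible_subset)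
  qed
  have "negligible {x \<in> {a + 1 / real (Suc n)..b - 1 / real (Suc n)}. f x \<noteq> 0}" for n
  proof (cases "a + 1 / real (Suc n) < b - 1 / real (Suc n)")
    case True
    then show ?thesis by (intro on_Icc) auto
  next
    case False
    then have "{x \<in> {a + 1 / real (Suc n)..b - 1 / real (Suc n)}. f x \<noteq> 0} \<subseteq> {a + 1 / real (Suc n)}"
      by auto
    then show ?thesis by (rule negligible_subset[rotated]) simp
  qed
  then have neg: "negligible (\<Union>n. {x \<in> {a + 1 / real (Suc n)..b - 1 / real (Suc n)}. f x \<noteq> 0})"
    by (intro negligible_Union_nat) blast
  have "{x \<in> {a<..<b}. f x \<noteq> 0} \<subseteq> (\<Union>n. {x \<in> {a + 1 / real (Suc n)..b - 1 / real (Suc n)}. f x \<noteq> 0})"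
  proof
    fix x assume x: "x \<in> {x \<in> {a<..<b}. f x \<noteq> 0}"
    then have "0 < min (x - a) (b - x)" by auto
    then obtain n where "inverse (real (Suc n)) < min (x - a) (b - x)"
      using reals_Archimedean by blast
    then show "x \<in> (\<Union>n. {x \<in> {a + 1 / real (Suc n)..b - 1 / real (Suc n)}. f x \<noteq> 0})"
      using x by (auto simp: inverse_eq_divide intro!: exI[of _ n])
  qed
  then have "{x \<in> {a<..<b}. f x \<noteq> 0} \<in> null_sets lebesgue"
    using neg negligible_subset by (auto simp: negligible_iff_null_sets[symmetric])
  then have "AE x in lebesgue. x \<in> {a<..<b} \<longrightarrow> f x = 0"
    by (auto dest!: AE_not_in elim!: eventually_mono)
  then show ?thesis
    by (simp add: AE_restrict_space_iff)
qed

lemma has_weak_deriv_unique_AE: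
  assumes "has_weak_deriv {a<..<b} w g" and "has_weak_deriv {a<..<b} w h"
  shows "AE x in lebesgue_on {a<..<b}. g x = h x"
proof -
  have "AE x in lebesgue_on {a<..<b}. g x - h x = 0"
    using assms weak_deriv_LINT_Icc_unique[OF assms]
    by (intro AE_eq_0_if_LINT_Icc_eq_0)
      (auto intro!: Bochner_Integration.integrable_diff has_weak_deriv_integrable_Icc)
  then show ?thesis by simp
qed

section \<open>Weak derivatives of finite element functions\<close>

text \<open>The derivative is assembled from the derivatives of the polynomial pieces on the interiors of the
elements, so that measurability and boundedness are evident; the exceptional set consists of the
nodes.\<close>

lemma fe_space_piecewise_derivative:
  assumes mesh: "mesh W \<T>" and w: "w \<in> fe_space W \<T> r"
  obtains g B S where "g \<in> borel_measurable borel" "\<And>x. \<bar>g x\<bar> \<le> B" "finite S"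
    "\<And>x. x \<in> W - S \<Longrightarrow> (w has_field_derivative g x) (at x)"
proof -
  have div: "\<T> division_of closure W"
    using mesh by (simp add: mesh_def)
  then have fin: "finite \<T>" by auto
  have "\<exists>P. \<forall>T\<in>\<T>. \<forall>x\<in>T. w x = poly (P T) x"
    using w unfolding fe_space_def mem_Collect_eq by (intro bchoice) blast
  then obtain P where P: "\<And>T x. T \<in> \<T> \<Longrightarrow> x \<in> T \<Longrightarrow> w x = poly (P T) x"
    by blast
  have "\<exists>B. \<forall>T\<in>\<T>. \<forall>x\<in>T. \<bar>poly (pderiv (P T)) x\<bar> \<le> B T"
  proof (intro bchoice ballI)
    fix T assume "T \<in> \<T>"
    then have "compact T" using div by (metis compact_cbox division_ofD(4))
    then have "bounded (poly (pderiv (P T)) ` T)"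
      by (intro compact_imp_bounded compact_continuous_image continuous_intros)
    then show "\<exists>B. \<forall>x\<in>T. \<bar>poly (pderiv (P T)) x\<bar> \<le> B"
      by (auto simp: bounded_iff)
  qed
  then obtain B where B: "\<And>T x. T \<in> \<T> \<Longrightarrow> x \<in> T \<Longrightarrow> \<bar>poly (pderiv (P T)) x\<bar> \<le> B T"
    by blast
  define g where "g x = (\<Sum>T\<in>\<T>. indicator (interior T) x * poly (pderiv (P T)) x)" for x
  show ?thesis
  proof (rule that[of g "\<Sum>T\<in>\<T>. \<bar>B T\<bar>" "\<Union>T\<in>\<T>. frontier T"])
    have "(\<lambda>x. poly Q x) \<in> borel_measurable borel" for Q :: "real poly"
      by (intro borel_measurable_continuous_onI continuous_intros)
    then show "g \<in> borel_measurable borel"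
      unfolding g_def by (intro borel_measurable_sum borel_measurable_times borel_measurable_indicator) auto
    show "\<bar>g x\<bar> \<le> (\<Sum>T\<in>\<T>. \<bar>B T\<bar>)" for x
      unfolding g_def
    proof (rule order_trans[OF sum_abs sum_mono])
      fix T assume "T \<in> \<T>"
      then show "\<bar>indicator (interior T) x * poly (pderiv (P T)) x\<bar> \<le> \<bar>B T\<bar>"
        using B[of T x] interior_subset[of T] by (auto simp: indicator_def)
    qed
    show "finite (\<Union>T\<in>\<T>. frontier T)"
    proof (intro finite_UN_I fin)
      fix T assume "T \<in> \<T>"
      then obtain c d where "T = {c..d}"
        using div by (metis box_real(2) division_ofD(4))
      then have "frontier T \<subseteq> {c, d}"
        by (auto simp: frontier_def)
      then show "finite (frontier T)" by (rule finite_subset) simp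
    qed
    show "(w has_field_derivative g x) (at x)" if x: "x \<in> W - (\<Union>T\<in>\<T>. frontier T)" for x
    proof -
      have "x \<in> \<Union>\<T>"
        using x closure_subset[of W] division_ofD(6)[OF div] by blast
      then obtain T where T: "T \<in> \<T>" "x \<in> interior T"
        using x closure_subset unfolding frontier_def by blast
      \<comment> \<open>The interiors of the elements are disjoint, so a single summand survives at \<open>x\<close>.\<close>
      have "g x = (\<Sum>T'\<in>\<T>. if T' = T then poly (pderiv (P T)) x else 0)"
        unfolding g_def
        using T division_ofD(5)[OF div] by (intro sum.cong) (auto simp: indicator_def)
      then have gx: "g x = poly (pderiv (P T)) x"
        using T fin by simp
      have "\<forall>\<^sub>F y in nhds x. w y = poly (P T) y"
        using eventually_nhds_in_open[of "interior T" x] T P interior_subset[of T]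
        by (auto elim!: eventually_mono)
      then show ?thesis
        unfolding gx by (subst DERIV_cong_ev[OF refl _ refl]) (auto intro: poly_DERIV)
    qed
  qed
qed

lemma piecewise_derivative_integral:
  fixes F g :: "real \<Rightarrow> real"
  assumes "a \<le> b" "continuous_on {a..b} F" "finite S"
    and "\<And>x. x \<in> {a<..<b} - S \<Longrightarrow> (F has_field_derivative g x) (at x)"
  shows "(g has_integral F b - F a) {a..b}"
  using assms
  by (intro fundamental_theorem_of_calculus_interior_strong[of S])
    (auto simp: has_real_derivative_iff_has_vector_derivative)

lemma continuous_on_Icc_bounded:
  fixes f :: "real \<Rightarrow> real"
  assumes "continuous_on {a..b} f"
  obtains B where "\<And>x. x \<in> {a..b} \<Longrightarrow> \<bar>f x\<bar> \<le> B"
  using compact_imp_bounded[OF compact_continuous_image[OF assms compact_Icc]]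
  by (metis bounded_iff imageI real_norm_def)

text \<open>Integration by parts: \<open>w * \<phi>\<close> is continuous, vanishes at both ends, and has derivative
\<open>w * \<phi>' + g * \<phi>\<close> off finitely many points. Continuity of \<open>w\<close> is what excludes jump terms at the nodes.\<close>

lemma has_weak_deriv_piecewise:
  assumes "a < b" and w: "continuous_on {a..b} w"
    and g: "g \<in> borel_measurable borel" and B: "\<And>x. \<bar>g x\<bar> \<le> B"
    and S: "finite S" and deriv: "\<And>x. x \<in> {a<..<b} - S \<Longrightarrow> (w has_field_derivative g x) (at x)"
  shows "has_weak_deriv {a<..<b} w g"
proof -
  have g_meas: "g \<in> borel_measurable (lebesgue_on K)" for K
    using g by (intro measurable_restrict_space1 measurable_completion) simp
  have w_meas: "w \<in> borel_measurable (lebesgue_on K)" if "K \<subseteq> {a..b}" "K \<in> sets lebesgue" for K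
    using that w by (intro continuous_imp_measurable_on_sets_lebesgue) (auto intro: continuous_on_subset)
  obtain A where A: "\<And>x. x \<in> {a..b} \<Longrightarrow> \<bar>w x\<bar> \<le> A"
    using continuous_on_Icc_bounded[OF w] by blast
  have "locally_integrable {a<..<b} w" "locally_integrable {a<..<b} g"
    unfolding locally_integrable_def
  proof (safe)
    fix K assume K: "compact K" "K \<subseteq> {a<..<b}"
    then have "K \<subseteq> {a..b}" by auto
    with K A show "integrable (lebesgue_on K) w"
      by (intro integrable_lebesgue_on_bounded[where B = A] w_meas lmeasurable_compact) 
        (auto intro: fmeasurableD lmeasurable_compact)
    show "integrable (lebesgue_on K) g"
      using K by (intro integrable_lebesgue_on_bounded[where B = B] g_meas lmeasurable_compact B)
  qed
  moreover have "(LINT x|lebesgue_on {a<..<b}. w x * deriv \<phi> x) = - (LINT x|lebesgue_on {a<..<b}. g x * \<phi> x)"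
    if "test_function {a<..<b} \<phi>" for \<phi>
  proof -
    have diff: "(deriv ^^ n) \<phi> field_differentiable (at x)" for n x
      using that by (simp add: test_function_def)
    have \<phi>': "(\<phi> has_field_derivative deriv \<phi> x) (at x)" for x
      using diff[of 0 x] by (simp add: DERIV_deriv_iff_field_differentiable)
    have cont: "continuous_on {a..b} \<phi>" "continuous_on {a..b} (deriv \<phi>)"
      using diff[of 0] diff[of 1]
      by (auto intro!: continuous_at_imp_continuous_on field_differentiable_imp_continuous_at)
    have outside: "\<phi> x = 0" if "x \<notin> {a<..<b}" for x
      using that \<open>test_function {a<..<b} \<phi>\<close> closure_subset[of "{x. \<phi> x \<noteq> 0}"]
      unfolding test_function_def by blast
    obtain A1 where A1: "\<And>x. x \<in> {a..b} \<Longrightarrow> \<bar>\<phi> x\<bar> \<le> A1"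
      using continuous_on_Icc_bounded[OF cont(1)] by blast
    obtain A2 where A2: "\<And>x. x \<in> {a..b} \<Longrightarrow> \<bar>deriv \<phi> x\<bar> \<le> A2"
      using continuous_on_Icc_bounded[OF cont(2)] by blast
    have meas: "\<phi> \<in> borel_measurable (lebesgue_on {a<..<b})" "deriv \<phi> \<in> borel_measurable (lebesgue_on {a<..<b})"
      using cont by (auto intro!: continuous_imp_measurable_on_sets_lebesgue intro: continuous_on_subset)
    have w_meas': "w \<in> borel_measurable (lebesgue_on {a<..<b})"
      by (rule w_meas) auto
    have int: "integrable (lebesgue_on {a<..<b}) (\<lambda>x. w x * deriv \<phi> x)"
      by (rule integrable_lebesgue_on_bounded[where B = "A * A2"])
        (use w_meas' meas A A1 A2 in \<open>auto simp: abs_mult intro!: mult_mono' borel_measurable_times\<close>)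
    have int': "integrable (lebesgue_on {a<..<b}) (\<lambda>x. g x * \<phi> x)"
      by (rule integrable_lebesgue_on_bounded[where B = "B * A1"])
        (use g_meas meas B A1 A2 in \<open>auto simp: abs_mult intro!: mult_mono' borel_measurable_times\<close>)
    have "((\<lambda>x. w x * deriv \<phi> x + g x * \<phi> x) has_integral w b * \<phi> b - w a * \<phi> a) {a..b}"
      using \<open>a < b\<close> w cont S
      by (intro piecewise_derivative_integral[where S = S])
        (auto intro!: continuous_intros derivative_eq_intros \<phi>' deriv)
    then have "integral {a..b} (\<lambda>x. w x * deriv \<phi> x + g x * \<phi> x) = 0"
      by (simp add: outside integral_unique)
    moreover have "(LINT x|lebesgue_on {a<..<b}. w x * deriv \<phi> x + g x * \<phi> x) =
        integral {a..b} (\<lambda>x. w x * deriv \<phi> x + g x * \<phi> x)"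
      using int int' by (intro LINT_Ioo_eq_integral_Icc Bochner_Integration.integrable_add)
    ultimately show ?thesis
      using int int' by simp
  qed
  ultimately show ?thesis
    by (simp add: has_weak_deriv_def)
qed

lemma borel_measurable_lebesgue_on_AE:
  fixes f g :: "real \<Rightarrow> real"
  assumes S: "S \<in> sets lebesgue" and f: "f \<in> borel_measurable (lebesgue_on S)"
    and eq: "AE x in lebesgue_on S. f x = g x"
  shows "g \<in> borel_measurable (lebesgue_on S)"
proof -
  have "(\<lambda>x. if x \<in> S then f x else 0) \<in> borel_measurable lebesgue"
    using S f by (simp add: borel_measurable_if)
  moreover have "AE x in lebesgue. (if x \<in> S then f x else 0) = (if x \<in> S then g x else 0)"
    using eq S by (auto simp: AE_restrict_space_iff elim!: eventually_mono)
  ultimately have "(\<lambda>x. if x \<in> S then g x else 0) \<in> borel_measurable lebesgue"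
    by (rule borel_measurable_AE)
  then show ?thesis
    using S by (simp add: borel_measurable_if)
qed

section \<open>The Poincare inequality for finite element functions\<close>

text \<open>Cauchy-Schwarz against the constant function \<open>1\<close>, obtained from the nonnegativity of the variance of
\<open>\<bar>f\<bar>\<close> about its mean \<open>m\<close>.\<close>

lemma LINT_abs_le_L2_norm:
  assumes "a < b" and f: "f \<in> L2 {a<..<b}"
  shows "integrable (lebesgue_on {a<..<b}) f"
    and "(LINT x|lebesgue_on {a<..<b}. \<bar>f x\<bar>) \<le> sqrt (b - a) * L2_norm {a<..<b} f"
proof -
  let ?M = "lebesgue_on {a<..<b}"
  have fm: "finite_measure ?M"
    by (rule finite_measure_lebesgue_on) simp
  have vol: "measure ?M {a<..<b} = b - a"
    using \<open>a < b\<close> by (simp add: measure_restrict_space)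
  have meas: "f \<in> borel_measurable ?M" and sq: "integrable ?M (\<lambda>x. (f x)\<^sup>2)"
    using f by (auto simp: L2_def)
  have const: "integrable ?M (\<lambda>x. c)" for c :: real
    using fm by (simp add: finite_measure.integrable_const)
  show int: "integrable ?M f"
  proof (rule Bochner_Integration.integrable_bound)
    show "integrable ?M (\<lambda>x. 1 + (f x)\<^sup>2)"
      using const sq by (rule Bochner_Integration.integrable_add)
    have "\<bar>y\<bar> \<le> 1 + y\<^sup>2" for y :: real
      using sum_squares_bound[of 1 "\<bar>y\<bar>"] by simp
    then show "AE x in ?M. norm (f x) \<le> norm (1 + (f x)\<^sup>2)"
      by (auto intro!: AE_I2)
  qed (rule meas)
  define I J m where "I = (LINT x|?M. \<bar>f x\<bar>)" "J = (LINT x|?M. (f x)\<^sup>2)" "m = I / (b - a)"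
  have "0 \<le> (LINT x|?M. (\<bar>f x\<bar> - m)\<^sup>2)"
    by simp
  also have "\<dots> = (LINT x|?M. (f x)\<^sup>2 - 2 * m * \<bar>f x\<bar> + m\<^sup>2)"
    by (simp add: power2_diff algebra_simps)
  also have "\<dots> = J - 2 * m * I + m\<^sup>2 * (b - a)"
    using int sq const by (simp add: I_J_m_def vol)
  also have "\<dots> = J - I\<^sup>2 / (b - a)"
  proof -
    have "m * (b - a) = I" "I\<^sup>2 / (b - a) = m * I"
      using \<open>a < b\<close> by (simp_all add: I_J_m_def(3) power2_eq_square)
    then show ?thesis
      by (simp add: power2_eq_square mult.assoc)
  qed
  finally have "I\<^sup>2 \<le> (b - a) * J"
    using \<open>a < b\<close> by (simp add: field_simps)
  then have "I \<le> sqrt ((b - a) * J)"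
    by (rule real_le_rsqrt)
  then show "I \<le> sqrt (b - a) * L2_norm {a<..<b} f"
    by (simp add: L2_norm_def I_J_m_def(2) real_sqrt_mult)
qed

text \<open>This is where the arbitrary choice in \<open>weak_deriv\<close> is eliminated: up to a null set it is the
piecewise derivative, and \<open>w\<close> is the primitive of the latter that vanishes at \<open>a\<close>.\<close>

lemma fe_space_derivative_representation:
  assumes "a < b" and mesh: "mesh {a<..<b} \<T>" and w: "w \<in> fe_space {a<..<b} \<T> r"
  obtains g where "g \<in> L2 {a<..<b}" "H10_norm {a<..<b} w = L2_norm {a<..<b} g"
    "\<And>x. x \<in> {a..b} \<Longrightarrow> (g has_integral w x) {a..x}"
proof -
  let ?M = "lebesgue_on {a<..<b}"
  obtain g B S where g: "g \<in> borel_measurable borel" "\<And>x. \<bar>g x\<bar> \<le> B" "finite S"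
    "\<And>x. x \<in> {a<..<b} - S \<Longrightarrow> (w has_field_derivative g x) (at x)"
    using fe_space_piecewise_derivative[OF mesh w] by blast
  have cont: "continuous_on {a..b} w" and "w a = 0"
    using w \<open>a < b\<close> by (auto simp: fe_space_def frontier_def)
  have weak: "has_weak_deriv {a<..<b} w g"
    by (rule has_weak_deriv_piecewise[OF \<open>a < b\<close> cont g])
  then have "has_weak_deriv {a<..<b} w (weak_deriv {a<..<b} w)"
    unfolding weak_deriv_def by (rule someI[of "has_weak_deriv {a<..<b} w"])
  with weak have AE: "AE x in ?M. g x = weak_deriv {a<..<b} w x"
    by (rule has_weak_deriv_unique_AE)
  have meas: "g \<in> borel_measurable ?M"
    using g(1) by (intro measurable_restrict_space1 measurable_completion) simp
  \<comment> \<open>Without measurability the integral of the square of \<open>weak_deriv\<close> could not be compared with that of \<open>g\<close>.\<close>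
  have meas': "weak_deriv {a<..<b} w \<in> borel_measurable ?M"
    by (rule borel_measurable_lebesgue_on_AE[OF _ meas AE]) simp
  show ?thesis
  proof (rule that)
    have "(g x)\<^sup>2 \<le> B\<^sup>2" for x
      using g(2)[of x] by (simp add: abs_le_square_iff[symmetric])
    with meas show "g \<in> L2 {a<..<b}"
      by (auto simp: L2_def intro!: integrable_lebesgue_on_bounded[where B = "B\<^sup>2"])
    have "(LINT x|?M. (weak_deriv {a<..<b} w x)\<^sup>2) = (LINT x|?M. (g x)\<^sup>2)"
      using AE meas meas' by (intro integral_cong_AE) auto
    then show "H10_norm {a<..<b} w = L2_norm {a<..<b} g"
      by (simp add: H10_norm_def L2_norm_def)
    show "(g has_integral w x) {a..x}" if "x \<in> {a..b}" for x
    proof -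
      have "continuous_on {a..x} w"
        using that by (intro continuous_on_subset[OF cont]) auto
      then show ?thesis
        using piecewise_derivative_integral[of a x w S g] that g(3,4) \<open>w a = 0\<close> by auto
    qed
  qed
qed

text \<open>Since \<open>w\<close> vanishes at \<open>a\<close>, \<open>w x\<close> is the integral of its derivative over \<open>[a, x]\<close>, which is bounded by
the \<open>L1\<close> norm and so by \<open>sqrt (b - a)\<close> times the \<open>L2\<close> norm of the derivative.\<close>

lemma fe_space_pointwise_bound:
  assumes "a < b" and "mesh {a<..<b} \<T>" and "w \<in> fe_space {a<..<b} \<T> r" and x: "x \<in> {a..b}"
  shows "\<bar>w x\<bar> \<le> sqrt (b - a) * H10_norm {a<..<b} w"
proof -
  obtain g where g: "g \<in> L2 {a<..<b}" "H10_norm {a<..<b} w = L2_norm {a<..<b} g"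
    "\<And>x. x \<in> {a..b} \<Longrightarrow> (g has_integral w x) {a..x}"
    using fe_space_derivative_representation[OF assms(1-3)] by blast
  note L1 = LINT_abs_le_L2_norm[OF \<open>a < b\<close> g(1)]
  have abs_int: "(\<lambda>y. \<bar>g y\<bar>) integrable_on {a..b}"
    using has_integral_integral_lebesgue_on[OF integrable_abs[OF L1(1)]]
    by (auto simp: has_integral_Icc_iff_Ioo integrable_on_def)
  then have abs_int': "(\<lambda>y. \<bar>g y\<bar>) integrable_on {a..x}"
    using x by (intro integrable_on_subinterval[OF abs_int]) auto
  have "\<bar>w x\<bar> = norm (integral {a..x} g)"
    using g(3)[OF x] by (simp add: integral_unique)
  also have "\<dots> \<le> integral {a..x} (\<lambda>y. \<bar>g y\<bar>)"
    using g(3)[OF x] abs_int' by (intro integral_norm_bound_integral) (auto simp: integrable_on_def)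
  also have "\<dots> \<le> integral {a..b} (\<lambda>y. \<bar>g y\<bar>)"
    using x abs_int abs_int' by (intro integral_subset_le) auto
  also have "\<dots> = (LINT y|lebesgue_on {a<..<b}. \<bar>g y\<bar>)"
    using L1(1) by (intro LINT_Ioo_eq_integral_Icc[symmetric] integrable_abs)
  finally show ?thesis
    using L1(2) g(2) by simp
qed

section \<open>Stability of the discrete solution\<close>

lemma H10_norm_nonneg: "0 \<le> H10_norm W w"
  by (simp add: H10_norm_def L2_norm_def)

lemma H10_norm_square: "(H10_norm W w)\<^sup>2 = L2_inner W (weak_deriv W w) (weak_deriv W w)"
  by (simp add: H10_norm_def L2_norm_def L2_inner_def power2_eq_square[symmetric])

text \<open>When the product is not integrable, its Bochner integral is \<open>0\<close> by convention and the bound is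
trivial; thus the lemma applies to the nonlinearity without a proof of its measurability.\<close>

lemma abs_LINT_mult_le:
  fixes f w :: "'a \<Rightarrow> real"
  assumes "integrable M f" and "0 \<le> A" and "\<And>x. x \<in> space M \<Longrightarrow> \<bar>w x\<bar> \<le> A"
  shows "\<bar>LINT x|M. f x * w x\<bar> \<le> A * (LINT x|M. \<bar>f x\<bar>)"
proof (cases "integrable M (\<lambda>x. f x * w x)")
  case True
  have "\<bar>LINT x|M. f x * w x\<bar> \<le> (LINT x|M. \<bar>f x * w x\<bar>)"
    by (rule integral_abs_bound)
  also have "\<dots> \<le> (LINT x|M. A * \<bar>f x\<bar>)"
    using assms integrable_abs[OF True]
    by (intro integral_mono) (auto simp: abs_mult mult.commute[of A] intro: mult_left_mono)
  finally show ?thesis by simp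
next
  case False
  then show ?thesis
    using \<open>0 \<le> A\<close> by (simp add: not_integrable_integral_eq)
qed

lemma abs_duality_map: "\<bar>duality_map q s\<bar> = \<bar>s\<bar> powr (q - 1)"
proof (cases "s = 0")
  case False
  then have "\<bar>s\<bar> powr (q - 2) * \<bar>s\<bar> powr 1 = \<bar>s\<bar> powr (q - 1)"
    by (simp only: powr_add[symmetric]) simp
  with False show ?thesis
    by (simp add: duality_map_def abs_mult)
qed (simp add: duality_map_def)

lemma le_if_square_le_mult:
  fixes x c :: real
  assumes "x\<^sup>2 \<le> c * x" "0 \<le> x" "0 \<le> c"
  shows "x \<le> c"
  using assms by (cases "x = 0") (simp_all add: power2_eq_square)

text \<open>The first discrete equation tested with \<open>\<psi> = v\<close>. One factor \<open>sqrt (b - a)\<close> comes from the pointwise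
bound on \<open>v\<close>, the other from passing from the \<open>L1\<close> norm of \<open>f\<close> to its \<open>L2\<close> norm.\<close>

lemma discrete_solution_v_bound:
  assumes "a < b" and "mesh {a<..<b} \<T>" and f: "f \<in> L2 {a<..<b}"
    and sol: "discrete_solution {a<..<b} \<T> r q f u v"
  shows "H10_norm {a<..<b} v \<le> (b - a) * L2_norm {a<..<b} f"
proof -
  let ?V = "H10_norm {a<..<b} v" and ?F = "L2_norm {a<..<b} f"
  have v: "v \<in> fe_space {a<..<b} \<T> r"
    using sol by (simp add: discrete_solution_def)
  have "?V\<^sup>2 = - L2_inner {a<..<b} f v"
    using sol v by (simp add: H10_norm_square discrete_solution_def)
  also have "\<dots> \<le> \<bar>LINT x|lebesgue_on {a<..<b}. f x * v x\<bar>"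
    by (simp add: L2_inner_def)
  also have "\<dots> \<le> sqrt (b - a) * ?V * (LINT x|lebesgue_on {a<..<b}. \<bar>f x\<bar>)"
    by (rule abs_LINT_mult_le[OF LINT_abs_le_L2_norm(1)[OF \<open>a < b\<close> f]])
      (use fe_space_pointwise_bound[OF assms(1,2) v] \<open>a < b\<close> in \<open>auto simp: H10_norm_nonneg\<close>)
  also have "\<dots> \<le> sqrt (b - a) * ?V * (sqrt (b - a) * ?F)"
    using LINT_abs_le_L2_norm(2)[OF \<open>a < b\<close> f] \<open>a < b\<close>
    by (intro mult_left_mono) (auto intro!: mult_nonneg_nonneg H10_norm_nonneg)
  also have "\<dots> = (b - a) * ?F * ?V"
    using \<open>a < b\<close> by (simp add: mult_ac)
  finally show ?thesis
    by (rule le_if_square_le_mult) (use \<open>a < b\<close> in \<open>auto simp: H10_norm_nonneg L2_norm_def\<close>)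
qed

text \<open>The second discrete equation tested with \<open>\<eta> = u\<close>. The nonlinearity is bounded through the pointwise
bound on \<open>v\<close>, which works alike for exponents \<open>q - 1\<close> below and above \<open>1\<close>.\<close>

lemma discrete_solution_u_bound:
  assumes "a < b" and "1 \<le> q" and "mesh {a<..<b} \<T>"
    and sol: "discrete_solution {a<..<b} \<T> r q f u v"
  shows "H10_norm {a<..<b} u
    \<le> (b - a) * sqrt (b - a) * (sqrt (b - a) * H10_norm {a<..<b} v) powr (q - 1)"
proof -
  let ?U = "H10_norm {a<..<b} u" and ?A = "sqrt (b - a) * H10_norm {a<..<b} v"
  have u: "u \<in> fe_space {a<..<b} \<T> r" and v: "v \<in> fe_space {a<..<b} \<T> r"
    using sol by (simp_all add: discrete_solution_def)
  let ?M = "lebesgue_on {a<..<b}"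
  have cont: "continuous_on {a<..<b} u"
    using u \<open>a < b\<close> by (auto simp: fe_space_def intro: continuous_on_subset)
  have int: "integrable ?M u"
    by (rule integrable_lebesgue_on_bounded[OF _ continuous_imp_measurable_on_sets_lebesgue[OF cont],
          where B = "sqrt (b - a) * ?U"])
      (use fe_space_pointwise_bound[OF assms(1,3) u] in auto)
  have "?U\<^sup>2 = - L2_inner {a<..<b} (\<lambda>x. duality_map q (v x)) u"
    using sol u by (simp add: H10_norm_square discrete_solution_def)
  also have "\<dots> \<le> \<bar>LINT x|?M. u x * duality_map q (v x)\<bar>"
    by (simp add: L2_inner_def mult.commute)
  also have "\<dots> \<le> ?A powr (q - 1) * (LINT x|?M. \<bar>u x\<bar>)"
  proof (rule abs_LINT_mult_le[OF int])
    show "\<bar>duality_map q (v x)\<bar> \<le> ?A powr (q - 1)" if "x \<in> space ?M" for x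
      unfolding abs_duality_map
      using fe_space_pointwise_bound[OF assms(1,3) v, of x] that \<open>1 \<le> q\<close>
      by (intro powr_mono2) auto
  qed simp
  also have "\<dots> \<le> ?A powr (q - 1) * (LINT x|?M. sqrt (b - a) * ?U)"
    using int fe_space_pointwise_bound[OF assms(1,3) u]
    by (intro mult_left_mono integral_mono integrable_abs finite_measure.integrable_const
        finite_measure_lebesgue_on) auto
  also have "(LINT x|?M. sqrt (b - a) * ?U) = (b - a) * (sqrt (b - a) * ?U)"
    using \<open>a < b\<close> by (simp add: measure_restrict_space)
  also have "?A powr (q - 1) * \<dots> = (b - a) * sqrt (b - a) * ?A powr (q - 1) * ?U"
    by (simp only: mult_ac)
  finally show ?thesis
    by (rule le_if_square_le_mult) (use \<open>a < b\<close> in \<open>auto simp: H10_norm_nonneg\<close>)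
qed

theorem theorem4p3:
  fixes a b p q :: real and \<Omega> :: "real set"
  assumes "a < b" and "\<Omega> = {a<..<b}"
    and "1 < p" and "q = p / (p - 1)"
  shows "\<exists>C::real. \<forall>(r::nat) (\<T> :: real set set) (f :: real \<Rightarrow> real) (u :: real \<Rightarrow> real) (v :: real \<Rightarrow> real).
    2 \<le> r \<longrightarrow> mesh \<Omega> \<T> \<longrightarrow> f \<in> L2 \<Omega> \<longrightarrow> discrete_solution \<Omega> \<T> r q f u v \<longrightarrow>
      H10_norm \<Omega> v \<le> C * L2_norm \<Omega> f \<and>
      H10_norm \<Omega> u \<le> C * L2_norm \<Omega> f powr (q - 1)"
proof -
  define L where "L = b - a"
  have L: "0 < L" using assms(1) by (simp add: L_def)
  have q: "1 \<le> q" using assms(3) by (simp add: assms(4) le_divide_eq)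
  \<comment> \<open>The two entries are the constants of the first estimate and of the second after inserting the first.\<close>
  define C where "C = max L (L * sqrt L * (sqrt L * L) powr (q - 1))"
  have "H10_norm \<Omega> v \<le> C * L2_norm \<Omega> f \<and> H10_norm \<Omega> u \<le> C * L2_norm \<Omega> f powr (q - 1)"
    if mesh: "mesh \<Omega> \<T>" and f: "f \<in> L2 \<Omega>" and sol: "discrete_solution \<Omega> \<T> r q f u v"
    for r \<T> f u v
  proof
    have F: "0 \<le> L2_norm \<Omega> f" by (simp add: L2_norm_def)
    have v: "H10_norm \<Omega> v \<le> L * L2_norm \<Omega> f"
      using discrete_solution_v_bound[OF assms(1)] mesh f sol by (simp add: assms(2) L_def)
    also have "\<dots> \<le> C * L2_norm \<Omega> f"
      using F by (intro mult_right_mono) (auto simp: C_def)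
    finally show "H10_norm \<Omega> v \<le> C * L2_norm \<Omega> f" .
    have "H10_norm \<Omega> u \<le> L * sqrt L * (sqrt L * H10_norm \<Omega> v) powr (q - 1)"
      using discrete_solution_u_bound[OF assms(1) q] mesh sol by (simp add: assms(2) L_def)
    also have "\<dots> \<le> L * sqrt L * (sqrt L * (L * L2_norm \<Omega> f)) powr (q - 1)"
      using L q v by (intro mult_left_mono powr_mono2) (auto simp: H10_norm_nonneg)
    also have "\<dots> = L * sqrt L * (sqrt L * L) powr (q - 1) * L2_norm \<Omega> f powr (q - 1)"
      using L F by (simp add: powr_mult mult_ac)
    also have "\<dots> \<le> C * L2_norm \<Omega> f powr (q - 1)"
      by (intro mult_right_mono) (auto simp: C_def)
    finally show "H10_norm \<Omega> u \<le> C * L2_norm \<Omega> f powr (q - 1)" .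
  qed
  then show ?thesis by blast
qed

end
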